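(* Let $k\ge3$. For any $k$-gon $P$, represented by $z\in\mathbb C^k$, with centroid $0$, $$ S(P)-4\tan\left(\frac\pi k\right)F(P)\ \ge\ 2\tan^2\left(\frac\pi k\right)\left\|z+\frac{i e^{-i\frac\pi k}\,\boldsymbol t}{2\sin\left(\frac\pi k\right)}\right\|^2 . $$ Equality holds if and only if $P$ has the form $\zeta_1R_1+\zeta_{k-1}R_{k-1}$ with $\zeta_1,\zeta_{k-1}\in\mathbb C$.
   Context: A $k$-gon $P$ is an ordered $k$-tuple $z=(z_0,\dots,z_{k-1})\in\mathbb C^k$ of points of the plane, identified with $\mathbb C$; indices are read modulo $k$. $P$ has centroid $0$ if $\sum_{\nu=0}^{k-1}z_\nu=0$. $\|\cdot\|$ is the norm of the Hermitian inner product $\langle z,w\rangle=\sum_{\nu=0}^{k-1}z_\nu\overline{w_\nu}$. The derivative (first difference) is $\dot z=(z_1-z_0,z_2-z_1,\dots,z_0-z_{k-1})$, and $\boldsymbol t=\dot z$ is the set of tangent vectors. $S(P)=\sum_{j=0}^{k-1}|z_{j+1}-z_j|^2=\|\dot z\|^2$ is the sum of the squares of the side lengths, and $F(P)=\frac1{4i}\sum_{j=0}^{k-1}(z_{j+1}\bar z_j-z_j\bar z_{j+1})$ is the signed area. Finally, $R_n=(1,\omega^n,\omega^{2n},\dots,\omega^{(k-1)n})$ with $\omega=e^{2\pi i/k}$. *)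

theory Defs
  imports Complex_Main "Jordan_Normal_Form.Matrix"
begin

text \<open>A \<open>k\<close>-gon is a vector \<open>z \<in> carrier_vec k\<close> over the complex numbers; its vertices are
  \<open>z $ 0, \<dots>, z $ (k - 1)\<close>. Reading indices modulo \<open>k\<close> is written out with \<open>mod\<close>.
  The Hermitian inner product is the library's \<open>z \<bullet>c w\<close>.\<close>

definition centroid_zero :: "complex vec \<Rightarrow> bool" where
  "centroid_zero z \<longleftrightarrow> (\<Sum>\<nu><dim_vec z. z $ \<nu>) = 0"

definition hnorm :: "complex vec \<Rightarrow> real" where
  "hnorm z = sqrt (Re (z \<bullet>c z))"

definition derivative :: "complex vec \<Rightarrow> complex vec" where
  "derivative z = vec (dim_vec z) (\<lambda>j. z $ (Suc j mod dim_vec z) - z $ j)"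

definition sq_side_sum :: "complex vec \<Rightarrow> real" where
  "sq_side_sum z = (\<Sum>j<dim_vec z. (cmod (z $ (Suc j mod dim_vec z) - z $ j))\<^sup>2)"

text \<open>The complex number under \<open>Re\<close> is real, see \<open>of_real_signed_area\<close> below.\<close>

definition signed_area :: "complex vec \<Rightarrow> real" where
  "signed_area z = Re (1 / (4 * \<i>) *
     (\<Sum>j<dim_vec z. z $ (Suc j mod dim_vec z) * cnj (z $ j)
                     - z $ j * cnj (z $ (Suc j mod dim_vec z))))"

definition regular_gon :: "nat \<Rightarrow> nat \<Rightarrow> complex vec" where
  "regular_gon k n = vec k (\<lambda>j. exp (2 * complex_of_real pi * \<i> / of_nat k) ^ (j * n))"

lemma inner_eq_sum:
  assumes "dim_vec z = dim_vec w"
  shows "z \<bullet>c w = (\<Sum>\<nu><dim_vec z. z $ \<nu> * cnj (w $ \<nu>))"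
  using assms by (simp add: scalar_prod_def atLeast0LessThan)

lemma hnorm_sq: "complex_of_real ((hnorm z)\<^sup>2) = z \<bullet>c z"
proof -
  have eq: "z \<bullet>c z = complex_of_real (\<Sum>\<nu><dim_vec z. (cmod (z $ \<nu>))\<^sup>2)"
    by (simp add: inner_eq_sum complex_norm_square del: of_real_power)
  moreover have "(\<Sum>\<nu><dim_vec z. (cmod (z $ \<nu>))\<^sup>2) \<ge> 0"
    by (simp add: sum_nonneg)
  ultimately show ?thesis
    unfolding hnorm_def by simp
qed

lemma sq_side_sum_eq: "sq_side_sum z = (hnorm (derivative z))\<^sup>2"
proof -
  have "complex_of_real (sq_side_sum z) = derivative z \<bullet>c derivative z"
    by (simp add: inner_eq_sum sq_side_sum_def derivative_def complex_norm_square
        del: of_real_power)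
  then show ?thesis
    by (metis hnorm_sq of_real_eq_iff)
qed

lemma of_real_signed_area:
  "complex_of_real (signed_area z) = 1 / (4 * \<i>) *
     (\<Sum>j<dim_vec z. z $ (Suc j mod dim_vec z) * cnj (z $ j)
                     - z $ j * cnj (z $ (Suc j mod dim_vec z)))"
  unfolding signed_area_def
  by (rule complex_eqI) (simp_all add: Re_divide Im_divide algebra_simps)

end

theory Submission
  imports Defs
begin

text \<open>
  Write \<open>\<theta> = \<pi> / k\<close>. The inequality is the discrete Wirtinger inequality
  \<open>\<parallel>t\<parallel>\<^sup>2 \<ge> 4 sin\<^sup>2 \<theta> \<parallel>z\<parallel>\<^sup>2\<close> for closed polygons with centroid \<open>0\<close>, in disguise. The coefficient of
  \<open>t\<close> is \<open>1/2 + (\<i>/2) cot \<theta>\<close>, and for a closed polygon \<open>\<langle>t, z\<rangle> = - S/2 + 2 \<i> F\<close>. Expanding the squared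
  norm on the right therefore produces exactly the area term on the left, and the difference of
  the two sides is \<open>(S - 4 sin\<^sup>2 \<theta> \<parallel>z\<parallel>\<^sup>2) / (2 cos\<^sup>2 \<theta>)\<close> (lemma \<open>isoperimetric_gap_eq\<close>).

  The Wirtinger defect is diagonal in the discrete Fourier basis \<open>R\<^sub>0, \<dots>, R\<^bsub>k-1\<^esub>\<close>: these vectors are
  orthogonal with squared norm \<open>k\<close>, and the cyclic difference multiplies \<open>R\<^sub>n\<close> by \<open>\<omega>\<^sup>n - 1\<close>, of modulus
  \<open>2 sin (n \<theta>)\<close>. A polygon with coefficients \<open>a\<^sub>n\<close> thus has defect
  \<open>4 k \<Sum>\<^sub>n (sin\<^sup>2 (n \<theta>) - sin\<^sup>2 \<theta>) |a\<^sub>n|\<^sup>2\<close> (lemma \<open>wirtinger_defect\<close>). The centroid condition is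
  \<open>a\<^sub>0 = 0\<close>, which removes the only negative weight; the weights of \<open>R\<^sub>1\<close> and \<open>R\<^bsub>k-1\<^esub>\<close> vanish
  and all others are positive, whence the equality case.
\<close>

section \<open>The discrete Fourier basis\<close>

definition unit_root :: "nat \<Rightarrow> complex" where
  "unit_root k = cis (2 * pi / real k)"

lemma unit_root_power: "unit_root k ^ n = cis (2 * pi * real n / real k)"
  by (simp add: unit_root_def DeMoivre mult_ac)

lemma unit_root_power_self: "k > 0 \<Longrightarrow> unit_root k ^ k = 1"
  by (simp add: unit_root_power)

lemma unit_root_power_mod:
  assumes "k > 0"
  shows "unit_root k ^ ((j mod k) * n) = unit_root k ^ (j * n)"
proof -
  have "unit_root k ^ j = unit_root k ^ (k * (j div k) + j mod k)"
    by simp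
  also have "\<dots> = unit_root k ^ (j mod k)"
    using assms by (simp only: power_add power_mult unit_root_power_self) simp
  finally show ?thesis
    by (simp add: power_mult)
qed

lemma dim_regular_gon: "dim_vec (regular_gon k n) = k"
  by (simp add: regular_gon_def)

lemma regular_gon_index:
  "j < k \<Longrightarrow> regular_gon k n $ j = unit_root k ^ (j * n)"
  by (simp add: regular_gon_def unit_root_def cis_conv_exp mult_ac)

text \<open>
  The summand is the \<open>j\<close>-th power of a \<open>k\<close>-th root of unity \<open>q\<close>, and the geometric sum over a full
  period vanishes unless \<open>q = 1\<close>.
\<close>

lemma unit_root_orthogonal:
  assumes "n < k" and "m < k"
  shows "(\<Sum>j<k. unit_root k ^ (j * n) * cnj (unit_root k ^ (j * m)))
           = (if n = m then of_nat k else 0)"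
proof -
  define q where "q = unit_root k ^ n * cnj (unit_root k ^ m)"
  have pos: "k > 0" using assms by simp
  have unit: "unit_root k ^ m * cnj (unit_root k ^ m) = 1" for m
    by (simp add: unit_root_power cis_cnj cis_mult)
  have sum: "(\<Sum>j<k. unit_root k ^ (j * n) * cnj (unit_root k ^ (j * m))) = (\<Sum>j<k. q ^ j)"
    by (simp add: q_def power_mult_distrib mult.commute[of _ n] mult.commute[of _ m] power_mult)
  show ?thesis
  proof (cases "n = m")
    case True
    then have "q = 1" using unit by (simp add: q_def)
    then show ?thesis using True sum by simp
  next
    case False
    have "q \<noteq> 1"
    proof
      assume "q = 1"
      then have "unit_root k ^ n = unit_root k ^ m"
        using unit[of m] unfolding q_def
        by (metis mult.commute mult.left_commute mult.right_neutral)
      then show False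
        using bij_betw_imp_inj_on[OF bij_betw_roots_unity[OF pos]] assms False
        by (auto simp: inj_on_def unit_root_power)
    qed
    moreover have "q ^ k = 1"
      by (simp add: q_def power_mult_distrib power_mult[symmetric] mult.commute[of _ k])
         (simp add: power_mult unit_root_power_self[OF pos] flip: complex_cnj_power)
    ultimately show ?thesis
      using sum False by (simp add: geometric_sum)
  qed
qed

lemma fourier_inversion:
  assumes "j < k"
  shows "f j = (\<Sum>n<k. ((\<Sum>i<k. f i * cnj (unit_root k ^ (i * n))) / of_nat k)
                        * unit_root k ^ (j * n))"
proof -
  have "(\<Sum>n<k. (\<Sum>i<k. f i * cnj (unit_root k ^ (i * n))) * unit_root k ^ (j * n))
      = (\<Sum>n<k. \<Sum>i<k. f i * (unit_root k ^ (n * j) * cnj (unit_root k ^ (n * i))))"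
    by (intro sum.cong refl) (simp add: sum_distrib_left mult_ac)
  also have "\<dots> = (\<Sum>i<k. f i * (\<Sum>n<k. unit_root k ^ (n * j) * cnj (unit_root k ^ (n * i))))"
    by (subst sum.swap) (simp add: sum_distrib_left)
  also have "\<dots> = (\<Sum>i<k. f i * (if j = i then of_nat k else 0))"
    by (intro sum.cong refl) (use assms in \<open>simp only: unit_root_orthogonal lessThan_iff\<close>)
  also have "\<dots> = (\<Sum>i<k. if j = i then f i * of_nat k else 0)"
    by (intro sum.cong refl) simp
  also have "\<dots> = f j * of_nat k"
    using assms by simp
  finally have "(\<Sum>n<k. (\<Sum>i<k. f i * cnj (unit_root k ^ (i * n))) * unit_root k ^ (j * n))
      = f j * of_nat k" .
  then show ?thesis
    using assms by (simp add: sum_divide_distrib[symmetric])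
qed

lemma parseval:
  "(\<Sum>j<k. (cmod (\<Sum>n<k. a n * unit_root k ^ (j * n)))\<^sup>2) = real k * (\<Sum>n<k. (cmod (a n))\<^sup>2)"
proof -
  have "complex_of_real (\<Sum>j<k. (cmod (\<Sum>n<k. a n * unit_root k ^ (j * n)))\<^sup>2)
      = (\<Sum>j<k. \<Sum>n<k. \<Sum>m<k. a n * cnj (a m)
           * (unit_root k ^ (j * n) * cnj (unit_root k ^ (j * m))))"
    by (simp add: complex_norm_square sum_product mult_ac del: of_real_power)
  also have "\<dots> = (\<Sum>n<k. \<Sum>j<k. \<Sum>m<k. a n * cnj (a m)
           * (unit_root k ^ (j * n) * cnj (unit_root k ^ (j * m))))"
    by (rule sum.swap)
  also have "\<dots> = (\<Sum>n<k. \<Sum>m<k. \<Sum>j<k. a n * cnj (a m)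
           * (unit_root k ^ (j * n) * cnj (unit_root k ^ (j * m))))"
    by (intro sum.cong refl sum.swap)
  also have "\<dots> = (\<Sum>n<k. \<Sum>m<k. a n * cnj (a m)
           * (\<Sum>j<k. unit_root k ^ (j * n) * cnj (unit_root k ^ (j * m))))"
    by (simp add: sum_distrib_left)
  also have "\<dots> = (\<Sum>n<k. \<Sum>m<k. a n * cnj (a m) * (if n = m then of_nat k else 0))"
    by (intro sum.cong refl) (simp only: unit_root_orthogonal lessThan_iff)
  also have "\<dots> = (\<Sum>n<k. \<Sum>m<k. if n = m then a n * cnj (a m) * of_nat k else 0)"
    by (intro sum.cong refl) simp
  also have "\<dots> = complex_of_real (real k * (\<Sum>n<k. (cmod (a n))\<^sup>2))"
    by (simp add: complex_norm_square sum_distrib_left mult_ac del: of_real_power)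
  finally show ?thesis
    by (simp only: of_real_eq_iff)
qed

section \<open>The discrete Wirtinger inequality\<close>

lemma cmod_cis_minus_1: "(cmod (cis x - 1))\<^sup>2 = 4 * (sin (x / 2))\<^sup>2"
proof -
  have "(cmod (cis x - 1))\<^sup>2 = 2 - 2 * cos (2 * (x / 2))"
    unfolding cmod_power2 using sin_cos_squared_add[of x]
    by (simp add: power2_eq_square algebra_simps)
  then show ?thesis
    by (simp only: cos_double_sin) simp
qed

text \<open>
  The coefficients are arbitrary, so that the formula can be applied both to the Fourier
  expansion of a polygon and to a given combination of \<open>R\<^sub>1\<close> and \<open>R\<^bsub>k-1\<^esub>\<close>.
\<close>

lemma wirtinger_defect:
  assumes "k > 0" and f: "\<And>j. j < k \<Longrightarrow> f j = (\<Sum>n<k. a n * unit_root k ^ (j * n))"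
  shows "(\<Sum>j<k. (cmod (f (Suc j mod k) - f j))\<^sup>2)
           - 4 * (sin (pi / real k))\<^sup>2 * (\<Sum>j<k. (cmod (f j))\<^sup>2)
         = 4 * real k * (\<Sum>n<k. ((sin (real n * (pi / real k)))\<^sup>2 - (sin (pi / real k))\<^sup>2)
                                  * (cmod (a n))\<^sup>2)"
proof -
  have diff: "f (Suc j mod k) - f j
      = (\<Sum>n<k. (a n * (unit_root k ^ n - 1)) * unit_root k ^ (j * n))" if "j < k" for j
  proof -
    have "f (Suc j mod k) = (\<Sum>n<k. a n * unit_root k ^ (Suc j * n))"
      using assms by (simp only: f mod_less_divisor unit_root_power_mod)
    then show ?thesis
      using that by (simp add: f sum_subtractf[symmetric] power_add algebra_simps)
  qed
  have factor: "(cmod (unit_root k ^ n - 1))\<^sup>2 = 4 * (sin (real n * (pi / real k)))\<^sup>2" for n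
    by (simp add: unit_root_power cmod_cis_minus_1 mult.commute)
  have "(\<Sum>j<k. (cmod (f (Suc j mod k) - f j))\<^sup>2)
      = (\<Sum>j<k. (cmod (\<Sum>n<k. (a n * (unit_root k ^ n - 1)) * unit_root k ^ (j * n)))\<^sup>2)"
    by (simp add: diff)
  also have "\<dots> = real k * (\<Sum>n<k. (cmod (a n))\<^sup>2 * (4 * (sin (real n * (pi / real k)))\<^sup>2))"
    by (simp only: parseval norm_mult power_mult_distrib factor)
  finally have S: "(\<Sum>j<k. (cmod (f (Suc j mod k) - f j))\<^sup>2)
      = real k * (\<Sum>n<k. (cmod (a n))\<^sup>2 * (4 * (sin (real n * (pi / real k)))\<^sup>2))" .
  have N: "(\<Sum>j<k. (cmod (f j))\<^sup>2) = real k * (\<Sum>n<k. (cmod (a n))\<^sup>2)"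
    by (simp add: f parseval)
  show ?thesis
    unfolding S N by (simp add: sum_distrib_left sum_subtractf[symmetric] algebra_simps)
qed

lemma sin_sq_diff: "(sin x)\<^sup>2 - (sin y)\<^sup>2 = sin (x - y) * sin (x + y :: real)"
proof -
  have "sin (x - y) * sin (x + y) = (sin x)\<^sup>2 * (cos y)\<^sup>2 - (cos x)\<^sup>2 * (sin y)\<^sup>2"
    by (simp add: sin_add sin_diff power2_eq_square algebra_simps)
  then show ?thesis
    by (simp add: cos_squared_eq algebra_simps)
qed

text \<open>
  By \<open>sin_sq_diff\<close> a Fourier weight is \<open>sin ((n - 1) \<theta>) sin ((n + 1) \<theta>)\<close>, and for \<open>1 < n < k - 1\<close>
  both angles lie strictly between \<open>0\<close> and \<open>\<pi>\<close>.
\<close>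

lemma wirtinger_weight_pos:
  assumes "1 < n" and "n < k - 1"
  shows "(sin (real n * (pi / real k)))\<^sup>2 - (sin (pi / real k))\<^sup>2 > 0"
proof -
  have pos: "real k > 0" using assms by simp
  have "real n * (pi / real k) - pi / real k = (real n - 1) * pi / real k"
    "real n * (pi / real k) + pi / real k = (real n + 1) * pi / real k"
    by (simp_all add: algebra_simps diff_divide_distrib add_divide_distrib)
  moreover have "(real n - 1) * pi / real k < pi" "(real n + 1) * pi / real k < pi"
    using pos assms by (simp_all add: pos_divide_less_eq)
  moreover have "(real n - 1) * pi / real k > 0" "(real n + 1) * pi / real k > 0"
    using pos assms by simp_all
  ultimately show ?thesis
    unfolding sin_sq_diff by (simp add: sin_gt_zero)
qed

lemma wirtinger_weight_extremal:
  assumes "k > 0" and "n = 1 \<or> n = k - 1"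
  shows "(sin (real n * (pi / real k)))\<^sup>2 - (sin (pi / real k))\<^sup>2 = 0"
proof -
  have "sin (real (k - 1) * (pi / real k)) = sin (pi - pi / real k)"
    using assms(1) by (simp add: of_nat_diff field_simps)
  then show ?thesis
    using assms(2) by auto
qed

lemma wirtinger_weighted_sum:
  fixes a :: "nat \<Rightarrow> complex"
  assumes "k > 0" and "a 0 = 0"
  defines "W \<equiv> (\<Sum>n<k. ((sin (real n * (pi / real k)))\<^sup>2 - (sin (pi / real k))\<^sup>2) * (cmod (a n))\<^sup>2)"
  shows "W \<ge> 0" and "W = 0 \<longleftrightarrow> (\<forall>n<k. n \<noteq> 1 \<and> n \<noteq> k - 1 \<longrightarrow> a n = 0)"
proof -
  let ?w = "\<lambda>n. (sin (real n * (pi / real k)))\<^sup>2 - (sin (pi / real k))\<^sup>2"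
  have classify: "n = 0 \<or> (n = 1 \<or> n = k - 1) \<or> 1 < n \<and> n < k - 1" if "n < k" for n
    using that by linarith
  have nonneg: "?w n * (cmod (a n))\<^sup>2 \<ge> 0" if "n < k" for n
    using classify[OF that] wirtinger_weight_pos[of n k] wirtinger_weight_extremal[OF assms(1), of n]
      assms(2) by (elim disjE) simp_all
  have zero: "?w n * (cmod (a n))\<^sup>2 = 0 \<longleftrightarrow> (n \<noteq> 1 \<and> n \<noteq> k - 1 \<longrightarrow> a n = 0)" if "n < k" for n
  proof (cases "n = 1 \<or> n = k - 1")
    case True
    then show ?thesis
      using wirtinger_weight_extremal[OF assms(1) True] by auto
  next
    case False
    then have "n = 0 \<or> ?w n > 0"
      using classify[OF that] wirtinger_weight_pos by blast
    then show ?thesis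
      using False assms(2) by auto
  qed
  show "W \<ge> 0"
    unfolding W_def by (intro sum_nonneg nonneg) simp
  have "W = 0 \<longleftrightarrow> (\<forall>n\<in>{..<k}. ?w n * (cmod (a n))\<^sup>2 = 0)"
    unfolding W_def by (rule sum_nonneg_eq_0_iff) (use nonneg in auto)
  then show "W = 0 \<longleftrightarrow> (\<forall>n<k. n \<noteq> 1 \<and> n \<noteq> k - 1 \<longrightarrow> a n = 0)"
    using zero by blast
qed

section \<open>Reduction of the isoperimetric inequality\<close>

lemma sum_cyclic_shift:
  fixes g :: "nat \<Rightarrow> 'a::comm_monoid_add"
  shows "(\<Sum>j<k. g (Suc j mod k)) = (\<Sum>j<k. g j)"
proof (cases k)
  case (Suc m)
  have "(\<Sum>j<Suc m. g (Suc j mod Suc m)) = (\<Sum>j<m. g (Suc j)) + g 0"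
    by simp
  also have "\<dots> = (\<Sum>j<Suc m. g j)"
    by (simp only: sum.lessThan_Suc_shift add.commute)
  finally show ?thesis using Suc by simp
qed simp

lemma sq_hnorm_eq_sum: "(hnorm z)\<^sup>2 = (\<Sum>j<dim_vec z. (cmod (z $ j))\<^sup>2)"
proof -
  have "complex_of_real ((hnorm z)\<^sup>2) = complex_of_real (\<Sum>j<dim_vec z. (cmod (z $ j))\<^sup>2)"
    unfolding hnorm_sq by (simp add: inner_eq_sum complex_norm_square del: of_real_power)
  then show ?thesis by (simp only: of_real_eq_iff)
qed

lemma signed_area_eq_Im:
  "signed_area z = (\<Sum>j<dim_vec z. Im (z $ (Suc j mod dim_vec z) * cnj (z $ j))) / 2"
proof -
  have "(\<Sum>j<dim_vec z. z $ (Suc j mod dim_vec z) * cnj (z $ j)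
                     - z $ j * cnj (z $ (Suc j mod dim_vec z)))
      = (\<Sum>j<dim_vec z. 2 * \<i> * complex_of_real (Im (z $ (Suc j mod dim_vec z) * cnj (z $ j))))"
    by (intro sum.cong refl) (simp add: complex_eq_iff)
  also have "\<dots> = 2 * \<i> * complex_of_real
      (\<Sum>j<dim_vec z. Im (z $ (Suc j mod dim_vec z) * cnj (z $ j)))"
    by (simp add: sum_distrib_left)
  finally show ?thesis
    unfolding signed_area_def by simp
qed

lemma tangent_coefficient:
  assumes "sin x \<noteq> 0"
  shows "\<i> * exp (- \<i> * complex_of_real x) / complex_of_real (2 * sin x)
           = Complex (1 / 2) (cos x / (2 * sin x))"
proof -
  have "exp (- \<i> * complex_of_real x) = cis (- x)"
    by (simp add: cis_conv_exp)
  then show ?thesis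
    using assms by (simp only: complex_eq_iff) (simp add: Re_divide_of_real Im_divide_of_real)
qed

text \<open>
  Expand the square and polarize \<open>2 Re ((v - u) cnj u) = |v|\<^sup>2 - |u|\<^sup>2 - |v - u|\<^sup>2\<close>. Summed over the
  sides of a closed polygon, the squared moduli of \<open>u\<close> and \<open>v\<close> give the same total \<open>\<parallel>z\<parallel>\<^sup>2\<close>, and the
  imaginary part of the coefficient brings in the summand \<open>Im (v cnj u)\<close> of twice the area.
\<close>

lemma cmod_shifted_vertex:
  fixes u v :: complex and x :: real
  assumes "sin x \<noteq> 0"
  shows "(cmod (u + Complex (1 / 2) (cos x / (2 * sin x)) * (v - u)))\<^sup>2
           = ((cmod v)\<^sup>2 + (cmod u)\<^sup>2) / 2 + (1 / (4 * (sin x)\<^sup>2) - 1 / 2) * (cmod (v - u))\<^sup>2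
             - cos x / sin x * Im (v * cnj u)"
proof -
  define c where "c = cos x / sin x"
  have csc: "1 / (4 * (sin x)\<^sup>2) = (1 + c\<^sup>2) / 4"
    unfolding c_def using assms sin_cos_squared_add[of x]
    by (simp add: power_divide field_simps)
  have half: "cos x / (2 * sin x) = c / 2"
    by (simp add: c_def)
  show ?thesis
    unfolding csc half c_def[symmetric] cmod_power2
    by (simp add: power2_eq_square field_simps)
qed

lemma isoperimetric_gap_eq:
  fixes z :: "complex vec" and x :: real
  assumes s: "sin x \<noteq> 0" and c: "cos x \<noteq> 0"
  shows "sq_side_sum z - 4 * tan x * signed_area z
           - 2 * (tan x)\<^sup>2 * (hnorm (z + (\<i> * exp (- \<i> * complex_of_real x)
                / complex_of_real (2 * sin x)) \<cdot>\<^sub>v derivative z))\<^sup>2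
         = (sq_side_sum z - 4 * (sin x)\<^sup>2 * (hnorm z)\<^sup>2) / (2 * (cos x)\<^sup>2)"
proof -
  define k where "k = dim_vec z"
  define \<alpha> where "\<alpha> = Complex (1 / 2) (cos x / (2 * sin x))"
  define S N F where "S = sq_side_sum z" and "N = (hnorm z)\<^sup>2" and "F = signed_area z"
  have "(hnorm (z + \<alpha> \<cdot>\<^sub>v derivative z))\<^sup>2
      = (\<Sum>j<k. (cmod (z $ j + \<alpha> * (z $ (Suc j mod k) - z $ j)))\<^sup>2)"
    by (simp add: sq_hnorm_eq_sum derivative_def k_def)
  also have "\<dots> = ((\<Sum>j<k. (cmod (z $ (Suc j mod k)))\<^sup>2) + (\<Sum>j<k. (cmod (z $ j))\<^sup>2)) / 2
      + (1 / (4 * (sin x)\<^sup>2) - 1 / 2) * (\<Sum>j<k. (cmod (z $ (Suc j mod k) - z $ j))\<^sup>2)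
      - cos x / sin x * (\<Sum>j<k. Im (z $ (Suc j mod k) * cnj (z $ j)))"
    unfolding \<alpha>_def cmod_shifted_vertex[OF s]
    by (simp only: sum.distrib sum_subtractf sum_distrib_left[symmetric]
        sum_divide_distrib[symmetric])
  also have "(\<Sum>j<k. (cmod (z $ (Suc j mod k)))\<^sup>2) = (\<Sum>j<k. (cmod (z $ j))\<^sup>2)"
    by (rule sum_cyclic_shift)
  also have "(\<Sum>j<k. (cmod (z $ j))\<^sup>2) = N"
    by (simp add: N_def k_def sq_hnorm_eq_sum)
  also have "(\<Sum>j<k. (cmod (z $ (Suc j mod k) - z $ j))\<^sup>2) = S"
    by (simp add: S_def k_def sq_side_sum_def)
  also have "(\<Sum>j<k. Im (z $ (Suc j mod k) * cnj (z $ j))) = 2 * F"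
    by (simp add: F_def k_def signed_area_eq_Im)
  finally have norm: "(hnorm (z + \<alpha> \<cdot>\<^sub>v derivative z))\<^sup>2
      = N + (1 / (4 * (sin x)\<^sup>2) - 1 / 2) * S - cos x / sin x * (2 * F)"
    by simp
  have "2 * (tan x)\<^sup>2 * (N + (1 / (4 * (sin x)\<^sup>2) - 1 / 2) * S - cos x / sin x * (2 * F))
      = 2 * (tan x)\<^sup>2 * N + (1 / (2 * (cos x)\<^sup>2) - (tan x)\<^sup>2) * S - 4 * tan x * F"
    using s c by (simp add: tan_def field_simps power2_eq_square)
  moreover have "S - (1 / (2 * (cos x)\<^sup>2) - (tan x)\<^sup>2) * S = S / (2 * (cos x)\<^sup>2)"
  proof -
    have "1 / (2 * (cos x)\<^sup>2) = (1 + (tan x)\<^sup>2) / 2"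
      unfolding tan_sec[OF c] by (simp add: field_simps)
    moreover have "S / (2 * (cos x)\<^sup>2) = S * (1 / (2 * (cos x)\<^sup>2))"
      by simp
    moreover have "S - ((1 + (tan x)\<^sup>2) / 2 - (tan x)\<^sup>2) * S = S * ((1 + (tan x)\<^sup>2) / 2)"
      by (simp add: algebra_simps add_divide_distrib)
    ultimately show ?thesis
      by (simp only:)
  qed
  moreover have "2 * (tan x)\<^sup>2 * N = 4 * (sin x)\<^sup>2 * N / (2 * (cos x)\<^sup>2)"
    by (simp add: tan_def power_divide)
  ultimately have "S - 4 * tan x * F
      - 2 * (tan x)\<^sup>2 * (N + (1 / (4 * (sin x)\<^sup>2) - 1 / 2) * S - cos x / sin x * (2 * F))
      = (S - 4 * (sin x)\<^sup>2 * N) / (2 * (cos x)\<^sup>2)"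
    by (simp add: diff_divide_distrib)
  then show ?thesis
    unfolding tangent_coefficient[OF s] \<alpha>_def[symmetric] norm S_def N_def F_def .
qed

section \<open>The isoperimetric inequality\<close>

lemma sum_two_harmonics:
  fixes a :: "nat \<Rightarrow> complex"
  assumes "k \<ge> 3" and "\<forall>n<k. n \<noteq> 1 \<and> n \<noteq> k - 1 \<longrightarrow> a n = 0"
  shows "(\<Sum>n<k. a n * e n) = a 1 * e 1 + a (k - 1) * e (k - 1)"
proof -
  have "(\<Sum>n<k. a n * e n) = (\<Sum>n\<in>{1, k - 1}. a n * e n)"
    by (rule sum.mono_neutral_right) (use assms in auto)
  then show ?thesis using assms(1) by simp
qed

lemma wirtinger_inequality:
  fixes z :: "complex vec"
  assumes "k \<ge> 3" and "z \<in> carrier_vec k" and "centroid_zero z"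
  shows "sq_side_sum z - 4 * (sin (pi / real k))\<^sup>2 * (hnorm z)\<^sup>2 \<ge> 0" (is "?D \<ge> 0")
    and "sq_side_sum z - 4 * (sin (pi / real k))\<^sup>2 * (hnorm z)\<^sup>2 = 0 \<longleftrightarrow>
         (\<exists>\<zeta>\<^sub>1 \<zeta>\<^sub>2. z = \<zeta>\<^sub>1 \<cdot>\<^sub>v regular_gon k 1 + \<zeta>\<^sub>2 \<cdot>\<^sub>v regular_gon k (k - 1))"
proof -
  have dim: "dim_vec z = k" and pos: "k > 0" using assms by auto
  define W :: "(nat \<Rightarrow> complex) \<Rightarrow> real" where
    "W a = (\<Sum>n<k. ((sin (real n * (pi / real k)))\<^sup>2 - (sin (pi / real k))\<^sup>2) * (cmod (a n))\<^sup>2)" for a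
  have defect: "?D = 4 * real k * W a"
    if "\<And>j. j < k \<Longrightarrow> z $ j = (\<Sum>n<k. a n * unit_root k ^ (j * n))" for a
    using wirtinger_defect[OF pos that]
    by (simp add: W_def sq_side_sum_def sq_hnorm_eq_sum dim)
  define a where "a n = (\<Sum>i<k. z $ i * cnj (unit_root k ^ (i * n))) / of_nat k" for n
  have expand: "z $ j = (\<Sum>n<k. a n * unit_root k ^ (j * n))" if "j < k" for j
    unfolding a_def using that by (rule fourier_inversion)
  have a0: "a 0 = 0"
    using assms(3) by (simp add: a_def centroid_zero_def dim)
  note sign = wirtinger_weighted_sum[of k a, OF pos a0, folded W_def]
  show "?D \<ge> 0"
    using defect[OF expand] sign(1) by simp
  show "?D = 0 \<longleftrightarrow> (\<exists>\<zeta>\<^sub>1 \<zeta>\<^sub>2. z = \<zeta>\<^sub>1 \<cdot>\<^sub>v regular_gon k 1 + \<zeta>\<^sub>2 \<cdot>\<^sub>v regular_gon k (k - 1))"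
  proof
    assume "?D = 0"
    then have "W a = 0"
      using defect[OF expand] pos by simp
    then have "\<forall>n<k. n \<noteq> 1 \<and> n \<noteq> k - 1 \<longrightarrow> a n = 0"
      using sign(2) by simp
    then have "z $ j = a 1 * unit_root k ^ (j * 1) + a (k - 1) * unit_root k ^ (j * (k - 1))"
      if "j < k" for j
      using expand[OF that] sum_two_harmonics[OF assms(1)] by simp
    then have "z = a 1 \<cdot>\<^sub>v regular_gon k 1 + a (k - 1) \<cdot>\<^sub>v regular_gon k (k - 1)"
      by (intro eq_vecI) (simp_all add: dim dim_regular_gon regular_gon_index)
    then show "\<exists>\<zeta>\<^sub>1 \<zeta>\<^sub>2. z = \<zeta>\<^sub>1 \<cdot>\<^sub>v regular_gon k 1 + \<zeta>\<^sub>2 \<cdot>\<^sub>v regular_gon k (k - 1)"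
      by blast
  next
    assume "\<exists>\<zeta>\<^sub>1 \<zeta>\<^sub>2. z = \<zeta>\<^sub>1 \<cdot>\<^sub>v regular_gon k 1 + \<zeta>\<^sub>2 \<cdot>\<^sub>v regular_gon k (k - 1)"
    then obtain \<zeta>\<^sub>1 \<zeta>\<^sub>2 where z: "z = \<zeta>\<^sub>1 \<cdot>\<^sub>v regular_gon k 1 + \<zeta>\<^sub>2 \<cdot>\<^sub>v regular_gon k (k - 1)"
      by blast
    define b where "b n = (if n = 1 then \<zeta>\<^sub>1 else if n = k - 1 then \<zeta>\<^sub>2 else 0)" for n
    have b: "\<forall>n<k. n \<noteq> 1 \<and> n \<noteq> k - 1 \<longrightarrow> b n = 0" and b0: "b 0 = 0"
      using assms(1) by (auto simp: b_def)
    have "b 1 = \<zeta>\<^sub>1" "b (k - 1) = \<zeta>\<^sub>2"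
      using assms(1) by (auto simp: b_def)
    then have "z $ j = (\<Sum>n<k. b n * unit_root k ^ (j * n))" if "j < k" for j
      using that by (simp add: z sum_two_harmonics[OF assms(1) b] dim_regular_gon regular_gon_index)
    then have "?D = 4 * real k * W b"
      by (rule defect)
    then show "?D = 0"
      using wirtinger_weighted_sum(2)[of k b, OF pos b0, folded W_def] b by simp
  qed
qed

theorem theorem2:
  fixes k :: nat and z :: "complex vec"
  assumes "k \<ge> 3" and "z \<in> carrier_vec k" and "centroid_zero z"
  shows "(sq_side_sum z - 4 * tan (pi / real k) * signed_area z
           \<ge> 2 * (tan (pi / real k))\<^sup>2 *
             (hnorm (z + (\<i> * exp (- \<i> * complex_of_real (pi / real k))
                / complex_of_real (2 * sin (pi / real k))) \<cdot>\<^sub>v derivative z))\<^sup>2)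
     \<and> (sq_side_sum z - 4 * tan (pi / real k) * signed_area z
           = 2 * (tan (pi / real k))\<^sup>2 *
             (hnorm (z + (\<i> * exp (- \<i> * complex_of_real (pi / real k))
                / complex_of_real (2 * sin (pi / real k))) \<cdot>\<^sub>v derivative z))\<^sup>2
         \<longleftrightarrow> (\<exists>\<zeta>\<^sub>1 \<zeta>\<^sub>2 :: complex. z = \<zeta>\<^sub>1 \<cdot>\<^sub>v regular_gon k 1 + \<zeta>\<^sub>2 \<cdot>\<^sub>v regular_gon k (k - 1)))"
proof -
  have angle: "0 < pi / real k" "pi / real k < pi / 2"
    using assms(1) by (simp_all add: field_simps)
  have s: "sin (pi / real k) > 0"
    using angle by (intro sin_gt_zero) linarith+
  have c: "cos (pi / real k) > 0"
    using angle by (intro cos_gt_zero) linarith+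
  let ?D = "sq_side_sum z - 4 * (sin (pi / real k))\<^sup>2 * (hnorm z)\<^sup>2"
  have "R \<le> L \<and> (L = R \<longleftrightarrow> ?D = 0)" if gap: "L - R = ?D / (2 * (cos (pi / real k))\<^sup>2)" for L R
  proof -
    have "L - R \<ge> 0"
      unfolding gap using wirtinger_inequality(1)[OF assms] by (intro divide_nonneg_nonneg) simp_all
    moreover have "L - R = 0 \<longleftrightarrow> ?D = 0"
      unfolding gap using c by simp
    ultimately show ?thesis by linarith
  qed
  note this[OF isoperimetric_gap_eq[OF less_imp_neq[OF s, symmetric] less_imp_neq[OF c, symmetric], of z]]
  then show ?thesis
    unfolding wirtinger_inequality(2)[OF assms] .
qed

end
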